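(* Let $X=l_{1}(\mathbb{N},\mathbb{R})$ be the real Banach space of absolutely summable sequences. Then $$wk_{X}(A)=\iota_{1}(A)$$ for each bounded subset $A$ of $X$.
   Context: For a bounded subset $A$ of a Banach space $X$, $wk_X(A)=\sup\{d(x^{**},X): x^{**}\in\overline{A}^{w^{*}}\}$, where $\overline{A}^{w^{*}}$ is the weak$^{*}$ closure of $A$ in $X^{**}$ and $d(x^{**},X)=\inf_{x\in X}\|x^{**}-x\|$. A sequence $(z_n)_n$ in a Banach space $Z$ is weakly $1$-summable if $\sum_n|\langle z^{*},z_n\rangle|<\infty$ for all $z^{*}\in Z^{*}$; then $\|(z_n)_n\|_1^w=\sup\{\sum_n|\langle z^{*},z_n\rangle|: z^{*}\in B_{Z^{*}}\}$, where $B_{Z^*}$ is the closed unit ball of $Z^*$, and $l_1^w(Z)$ denotes the space of such sequences. For a bounded subset $A$ of a Banach space $X$, $$\iota_{1}(A)=\sup\Big\{\limsup_{n}\sup_{x\in A}|\langle x^{*}_{n},x\rangle|: (x^{*}_{n})_{n}\in l^{w}_{1}(X^{*}),\ \|(x^{*}_{n})_{n}\|_{1}^{w}\leq 1\Big\}.$$ *)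

theory Defs
  imports "HOL-Analysis.Analysis"
begin

section \<open>The Banach space of absolutely summable real sequences\<close>

typedef l1 = "{f :: nat \<Rightarrow> real. summable (\<lambda>n. \<bar>f n\<bar>)}"
  morphisms l1_nth Abs_l1
  by (rule exI[of _ "\<lambda>_. 0"]) simp

setup_lifting type_definition_l1

lemma summable_abs_l1_nth: "summable (\<lambda>n. \<bar>l1_nth x n\<bar>)"
  using l1_nth[of x] by simp

lemma l1_eqI: "(\<And>n. l1_nth x n = l1_nth y n) \<Longrightarrow> x = y"
  by (simp add: l1_nth_inject[symmetric] fun_eq_iff)

instantiation l1 :: real_vector
begin

lift_definition zero_l1 :: l1 is "\<lambda>_. 0"
  by simp

lift_definition plus_l1 :: "l1 \<Rightarrow> l1 \<Rightarrow> l1" is "\<lambda>f g n. f n + g n"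
proof -
  fix f g :: "nat \<Rightarrow> real"
  assume "summable (\<lambda>n. \<bar>f n\<bar>)" "summable (\<lambda>n. \<bar>g n\<bar>)"
  then have "summable (\<lambda>n. \<bar>f n\<bar> + \<bar>g n\<bar>)"
    by (rule summable_add)
  then show "summable (\<lambda>n. \<bar>f n + g n\<bar>)"
    by (rule summable_comparison_test'[where N = 0]) auto
qed

lift_definition uminus_l1 :: "l1 \<Rightarrow> l1" is "\<lambda>f n. - f n"
  by simp

lift_definition minus_l1 :: "l1 \<Rightarrow> l1 \<Rightarrow> l1" is "\<lambda>f g n. f n - g n"
proof -
  fix f g :: "nat \<Rightarrow> real"
  assume "summable (\<lambda>n. \<bar>f n\<bar>)" "summable (\<lambda>n. \<bar>g n\<bar>)"
  then have "summable (\<lambda>n. \<bar>f n\<bar> + \<bar>g n\<bar>)"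
    by (rule summable_add)
  then show "summable (\<lambda>n. \<bar>f n - g n\<bar>)"
    by (rule summable_comparison_test'[where N = 0]) auto
qed

lift_definition scaleR_l1 :: "real \<Rightarrow> l1 \<Rightarrow> l1" is "\<lambda>c f n. c * f n"
  by (simp add: abs_mult summable_mult)

instance
proof
  fix x y z :: l1 and a b :: real
  show "x + y + z = x + (y + z)" "x + y = y + x" "0 + x = x" "- x + x = 0" "x - y = x + - y"
    "a *\<^sub>R (x + y) = a *\<^sub>R x + a *\<^sub>R y" "(a + b) *\<^sub>R x = a *\<^sub>R x + b *\<^sub>R x"
    "a *\<^sub>R b *\<^sub>R x = (a * b) *\<^sub>R x" "1 *\<^sub>R x = x"
    by (transfer; simp add: algebra_simps fun_eq_iff)+
qed

end

instantiation l1 :: real_normed_vector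
begin

definition norm_l1 :: "l1 \<Rightarrow> real"
  where "norm_l1 x = (\<Sum>n. \<bar>l1_nth x n\<bar>)"

definition dist_l1 :: "l1 \<Rightarrow> l1 \<Rightarrow> real"
  where "dist_l1 x y = norm (x - y)"

definition sgn_l1 :: "l1 \<Rightarrow> l1"
  where "sgn_l1 x = x /\<^sub>R norm x"

definition uniformity_l1 :: "(l1 \<times> l1) filter"
  where "uniformity_l1 = (INF e\<in>{0 <..}. principal {(x, y). dist x y < e})"

definition open_l1 :: "l1 set \<Rightarrow> bool"
  where "open_l1 S = (\<forall>x\<in>S. \<forall>\<^sub>F (x', y) in uniformity. x' = x \<longrightarrow> y \<in> S)"

instance
proof
  fix x y :: l1 and a :: real
  show "dist x y = norm (x - y)"
    by (rule dist_l1_def)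
  show "sgn x = x /\<^sub>R norm x"
    by (rule sgn_l1_def)
  show "uniformity = (INF e\<in>{0 <..}. principal {(x, y :: l1). dist x y < e})"
    by (rule uniformity_l1_def)
  show "open S \<longleftrightarrow> (\<forall>x\<in>S. \<forall>\<^sub>F (x', y) in uniformity. x' = x \<longrightarrow> y \<in> S)" for S :: "l1 set"
    by (rule open_l1_def)
  show "norm x = 0 \<longleftrightarrow> x = 0"
  proof -
    have "norm x = 0 \<longleftrightarrow> (\<forall>n. l1_nth x n = 0)"
      unfolding norm_l1_def
      using suminf_eq_zero_iff[OF summable_abs_l1_nth[of x]] by simp
    also have "\<dots> \<longleftrightarrow> x = 0"
      by transfer (simp add: fun_eq_iff)
    finally show ?thesis .
  qed
  show "norm (x + y) \<le> norm x + norm y"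
  proof -
    have "norm (x + y) \<le> (\<Sum>n. \<bar>l1_nth x n\<bar> + \<bar>l1_nth y n\<bar>)"
      unfolding norm_l1_def
      by (intro suminf_le summable_abs_l1_nth summable_add)
         (simp add: plus_l1.rep_eq abs_triangle_ineq)
    also have "\<dots> = norm x + norm y"
      unfolding norm_l1_def by (rule suminf_add[symmetric]) (rule summable_abs_l1_nth)+
    finally show ?thesis .
  qed
  show "norm (a *\<^sub>R x) = \<bar>a\<bar> * norm x"
    unfolding norm_l1_def scaleR_l1.rep_eq abs_mult
    by (rule suminf_mult) (rule summable_abs_l1_nth)
qed

end

lemma sum_abs_l1_nth_le_norm: "(\<Sum>n<N. \<bar>l1_nth x n\<bar>) \<le> norm x"
  unfolding norm_l1_def by (rule sum_le_suminf) (auto intro: summable_abs_l1_nth)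

lemma abs_l1_nth_le_norm: "\<bar>l1_nth x n\<bar> \<le> norm x"
proof -
  have "\<bar>l1_nth x n\<bar> \<le> (\<Sum>k<Suc n. \<bar>l1_nth x k\<bar>)"
    by (rule member_le_sum) auto
  with sum_abs_l1_nth_le_norm[of x "Suc n"] show ?thesis
    by linarith
qed

instance l1 :: banach
proof
  fix X :: "nat \<Rightarrow> l1"
  assume X: "Cauchy X"
  have "Cauchy (\<lambda>m. l1_nth (X m) n)" for n
    unfolding Cauchy_def
  proof (intro allI impI)
    fix e :: real
    assume "e > 0"
    with X obtain M where M: "\<And>m k. m \<ge> M \<Longrightarrow> k \<ge> M \<Longrightarrow> dist (X m) (X k) < e"
      unfolding Cauchy_def by meson
    have "dist (l1_nth (X m) n) (l1_nth (X k) n) < e" if "m \<ge> M" "k \<ge> M" for m k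
      using abs_l1_nth_le_norm[of "X m - X k" n] M[OF that]
      by (simp add: dist_norm minus_l1.rep_eq)
    then show "\<exists>M. \<forall>m\<ge>M. \<forall>k\<ge>M. dist (l1_nth (X m) n) (l1_nth (X k) n) < e"
      by blast
  qed
  then have "\<forall>n. \<exists>l. (\<lambda>m. l1_nth (X m) n) \<longlonglongrightarrow> l"
    by (simp add: Cauchy_convergent_iff convergent_def)
  then obtain f where f: "\<And>n. (\<lambda>m. l1_nth (X m) n) \<longlonglongrightarrow> f n"
    by metis
  have tail: "(\<Sum>n<N. \<bar>l1_nth (X k) n - f n\<bar>) \<le> e"
    if "\<And>m k. m \<ge> M \<Longrightarrow> k \<ge> M \<Longrightarrow> dist (X m) (X k) < e" and "k \<ge> M" for M k N e
  proof (rule tendsto_upperbound)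
    show "(\<lambda>m. \<Sum>n<N. \<bar>l1_nth (X k) n - l1_nth (X m) n\<bar>) \<longlonglongrightarrow> (\<Sum>n<N. \<bar>l1_nth (X k) n - f n\<bar>)"
      by (intro tendsto_intros f)
    have "(\<Sum>n<N. \<bar>l1_nth (X k) n - l1_nth (X m) n\<bar>) \<le> e" if "m \<ge> M" for m
      using sum_abs_l1_nth_le_norm[of "X k - X m" N]
        \<open>\<And>m k. m \<ge> M \<Longrightarrow> k \<ge> M \<Longrightarrow> dist (X m) (X k) < e\<close>[OF \<open>k \<ge> M\<close> that]
      by (simp add: minus_l1.rep_eq dist_norm)
    then show "\<forall>\<^sub>F m in sequentially. (\<Sum>n<N. \<bar>l1_nth (X k) n - l1_nth (X m) n\<bar>) \<le> e"
      using eventually_sequentially by blast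
  qed simp
  obtain M1 where M1: "\<And>m k. m \<ge> M1 \<Longrightarrow> k \<ge> M1 \<Longrightarrow> dist (X m) (X k) < 1"
    using X unfolding Cauchy_def by (meson zero_less_one)
  have "summable (\<lambda>n. \<bar>l1_nth (X M1) n - f n\<bar>)"
    using tail[OF M1 order_refl] by (intro summableI_nonneg_bounded[where x = 1]) auto
  from summable_add[OF this summable_abs_l1_nth[of "X M1"]]
  have "summable (\<lambda>n. \<bar>f n\<bar>)"
    by (rule summable_comparison_test'[where N = 0]) auto
  then have nth: "l1_nth (Abs_l1 f) = f"
    by (simp add: Abs_l1_inverse)
  have "X \<longlonglongrightarrow> Abs_l1 f"
    unfolding lim_sequentially
  proof (intro allI impI)
    fix e :: real
    assume "e > 0"
    then have "e / 2 > 0"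
      by simp
    with X obtain M where M: "\<And>m k. m \<ge> M \<Longrightarrow> k \<ge> M \<Longrightarrow> dist (X m) (X k) < e / 2"
      unfolding Cauchy_def by meson
    have "dist (X k) (Abs_l1 f) < e" if "k \<ge> M" for k
    proof -
      have "(\<Sum>n. \<bar>l1_nth (X k - Abs_l1 f) n\<bar>) \<le> e / 2"
        using tail[OF M that] by (intro suminf_le_const summable_abs_l1_nth)
          (simp add: minus_l1.rep_eq nth)
      with \<open>e > 0\<close> show ?thesis
        by (simp add: dist_norm norm_l1_def)
    qed
    then show "\<exists>M. \<forall>k\<ge>M. dist (X k) (Abs_l1 f) < e"
      by blast
  qed
  then show "convergent X"
    by (auto simp: convergent_def)
qed


section \<open>The measure of weak non-compactness\<close>

lift_definition bidual_embed :: "'a::real_normed_vector \<Rightarrow> ('a \<Rightarrow>\<^sub>L real) \<Rightarrow>\<^sub>L real"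
  is "\<lambda>x f. blinfun_apply f x"
  by (rule blinfun.bounded_linear_left)

text \<open>On functionals, the strong operator topology is the topology of pointwise convergence,
  that is, the weak* topology.\<close>

abbreviation weak_star_topology :: "('a::real_normed_vector \<Rightarrow>\<^sub>L real) topology"
  where "weak_star_topology \<equiv> strong_operator_topology"

text \<open>The quantities below take values in \<^typ>\<open>ennreal\<close>, so that every supremum exists
  and the supremum over the empty set is 0; this covers the bounded set \<open>A = {}\<close>.\<close>

definition wk :: "'a::banach set \<Rightarrow> ennreal"
  where "wk A = (SUP \<phi> \<in> weak_star_topology closure_of (bidual_embed ` A).
                   ennreal (infdist \<phi> (range (bidual_embed :: 'a \<Rightarrow> _))))"


section \<open>Weakly 1-summable sequences and the quantity iota\<close>

definition weakly_1_summable :: "(nat \<Rightarrow> 'a::banach) \<Rightarrow> bool"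
  where "weakly_1_summable z \<longleftrightarrow> (\<forall>f :: 'a \<Rightarrow>\<^sub>L real. summable (\<lambda>n. \<bar>blinfun_apply f (z n)\<bar>))"

definition weak_1_norm :: "(nat \<Rightarrow> 'a::banach) \<Rightarrow> ennreal"
  where "weak_1_norm z =
    (SUP f \<in> cball (0 :: 'a \<Rightarrow>\<^sub>L real) 1. \<Sum>n. ennreal \<bar>blinfun_apply f (z n)\<bar>)"

definition iota1 :: "'a::banach set \<Rightarrow> ennreal"
  where "iota1 A =
    (SUP g \<in> {g :: nat \<Rightarrow> ('a \<Rightarrow>\<^sub>L real). weakly_1_summable g \<and> weak_1_norm g \<le> 1}.
       limsup (\<lambda>n. SUP x\<in>A. ennreal \<bar>blinfun_apply (g n) x\<bar>))"

end

theory Submission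
  imports Defs
begin

text \<open>
  The inequality \<open>iota1 A \<le> wk A\<close> holds in every Banach space. Let \<open>(g n)\<close> be weakly 1-summable
  of norm at most 1, and let \<open>\<bar>g n (x n)\<bar> \<ge> c\<close> with \<open>x n \<in> A\<close> for infinitely many \<open>n\<close>. Each
  row of the matrix \<open>\<bar>g n (x k)\<bar>\<close> has sum at most \<open>norm (x k)\<close>, so Rosenthal's lemma
  (\<open>rosenthal_disjointification\<close>) provides an infinite set \<open>M\<close> of indices on which the
  off-diagonal row sums are at most \<open>\<epsilon>\<close>. The functionals \<open>h m = (\<Sum>n\<in>M, n \<ge> m. \<plusminus> g n)\<close> lie in
  the unit ball of the dual and, with signs chosen to make the diagonal terms positive, satisfy
  \<open>h m (x k) \<ge> c - \<epsilon>\<close> for all \<open>k \<in> M\<close> with \<open>k \<ge> m\<close>; but \<open>h m v\<close> tends to 0 for every fixed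
  \<open>v\<close>. Hence a weak* cluster point \<open>\<phi>\<close> of \<open>(x k)\<close> along \<open>M\<close> has \<open>\<phi> (h m) \<ge> c - \<epsilon>\<close> for all
  \<open>m\<close>, so its distance to every \<open>v\<close> in the space is at least \<open>c - 2 * \<epsilon>\<close>
  (\<open>weak_star_closure_point_far_from_space\<close>).

  For the converse in the space of absolutely summable sequences, both quantities are compared
  with the size of the tails \<open>\<Sum>n\<ge>N. \<bar>x n\<bar>\<close> of the elements \<open>x\<close> of \<open>A\<close>. If these are at most \<open>c\<close> for
  some \<open>N\<close>, then every point of the weak* closure is within \<open>c\<close> of its projection to the first
  \<open>N\<close> coordinates (\<open>infdist_weak_star_closure_le_tail\<close>). If instead for every \<open>N\<close> some tail
  exceeds \<open>c\<close>, then there are consecutive blocks of coordinates such that on each block some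
  element of \<open>A\<close> has mass more than \<open>c\<close>. The sign patterns of these elements on the blocks have
  disjoint supports, so they form a weakly 1-summable sequence of norm at most 1, which shows
  \<open>iota1 A \<ge> c\<close> (\<open>iota1_ge_if_tails_large\<close>).
\<close>

section \<open>Disjointification of matrices with bounded rows\<close>

lemma infinite_partition_into_infinite_sets:
  fixes I :: "nat set"
  assumes "infinite I"
  shows "\<exists>N :: nat \<Rightarrow> nat set. (\<forall>p. N p \<subseteq> I \<and> infinite (N p)) \<and> (\<forall>p q. p \<noteq> q \<longrightarrow> N p \<inter> N q = {})"
proof -
  define e where "e = (\<lambda>p q. enumerate I (prod_encode (p, q)))"
  have inj: "inj (enumerate I)"
    using strict_mono_enumerate[OF assms] by (rule strict_mono_imp_inj_on)
  have "range (e p) \<subseteq> I" for p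
    using enumerate_in_set[OF assms] by (auto simp: e_def)
  moreover have "infinite (range (e p))" for p
    by (rule range_inj_infinite) (auto simp: e_def inj_on_def inj_eq[OF inj])
  moreover have "range (e p) \<inter> range (e q) = {}" if "p \<noteq> q" for p q
    using that by (auto simp: e_def inj_eq[OF inj])
  ultimately show ?thesis
    by (intro exI[of _ "\<lambda>p. range (e p)"]) blast
qed

text \<open>
  Rosenthal's lemma. Split the index set into infinitely many infinite blocks. Either some block
  works, or every block contains a row \<open>k p\<close> with off-diagonal sum more than \<open>\<epsilon>\<close> inside its own
  block. In the second case, restricting the matrix to the indices \<open>k p\<close> lowers the bound on the
  row sums by \<open>\<epsilon>\<close>, which can happen only finitely often. The row sums are expressed by finite
  partial sums, so that the passage to a subset of indices raises no question of convergence.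
\<close>

lemma rosenthal_disjointification:
  fixes a :: "nat \<Rightarrow> nat \<Rightarrow> real"
  assumes "infinite I" and "\<epsilon> > 0"
    and rows: "\<And>k F. k \<in> I \<Longrightarrow> finite F \<Longrightarrow> F \<subseteq> I \<Longrightarrow> (\<Sum>n\<in>F. a k n) \<le> R"
  obtains M where "M \<subseteq> I" "infinite M"
    "\<And>k F. k \<in> M \<Longrightarrow> finite F \<Longrightarrow> F \<subseteq> M - {k} \<Longrightarrow> (\<Sum>n\<in>F. a k n) \<le> \<epsilon>"
proof -
  have *: "\<exists>M\<subseteq>I. infinite M \<and> (\<forall>k\<in>M. \<forall>F. finite F \<and> F \<subseteq> M - {k} \<longrightarrow> (\<Sum>n\<in>F. a k n) \<le> \<epsilon>)"
    if "infinite I" "\<And>k F. k \<in> I \<Longrightarrow> finite F \<Longrightarrow> F \<subseteq> I \<Longrightarrow> (\<Sum>n\<in>F. a k n) \<le> real j * \<epsilon>" for I j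
    using that
  proof (induction j arbitrary: I)
    case 0
    have "(\<Sum>n\<in>F. a k n) \<le> \<epsilon>" if "k \<in> I" "finite F" "F \<subseteq> I - {k}" for k F
    proof -
      have "F \<subseteq> I"
        using that(3) by blast
      with "0.prems"(2)[OF that(1,2)] \<open>\<epsilon> > 0\<close> show ?thesis
        by simp
    qed
    with "0.prems"(1) show ?case
      by blast
  next
    case (Suc j)
    obtain N :: "nat \<Rightarrow> nat set"
      where "\<forall>p. N p \<subseteq> I \<and> infinite (N p)" "\<forall>p q. p \<noteq> q \<longrightarrow> N p \<inter> N q = {}"
      using infinite_partition_into_infinite_sets[OF Suc.prems(1)] by blast
    then have N: "\<And>p. N p \<subseteq> I" "\<And>p. infinite (N p)" "\<And>p q. p \<noteq> q \<Longrightarrow> N p \<inter> N q = {}"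
      by simp_all
    show ?case
    proof (cases "\<exists>p. \<forall>k\<in>N p. \<forall>F. finite F \<and> F \<subseteq> N p - {k} \<longrightarrow> (\<Sum>n\<in>F. a k n) \<le> \<epsilon>")
      case True
      then obtain p where "\<forall>k\<in>N p. \<forall>F. finite F \<and> F \<subseteq> N p - {k} \<longrightarrow> (\<Sum>n\<in>F. a k n) \<le> \<epsilon>"
        by blast
      with N(1,2)[of p] show ?thesis
        by (intro exI[of _ "N p"] conjI)
    next
      case False
      then have "\<forall>p. \<exists>k F. k \<in> N p \<and> finite F \<and> F \<subseteq> N p - {k} \<and> (\<Sum>n\<in>F. a k n) > \<epsilon>"
        by (meson not_le)
      then obtain k where "\<forall>p. \<exists>F. k p \<in> N p \<and> finite F \<and> F \<subseteq> N p - {k p} \<and> (\<Sum>n\<in>F. a (k p) n) > \<epsilon>"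
        unfolding choice_iff by blast
      then obtain F where kF: "\<And>p. k p \<in> N p" "\<And>p. finite (F p)" "\<And>p. F p \<subseteq> N p - {k p}"
        "\<And>p. (\<Sum>n\<in>F p. a (k p) n) > \<epsilon>"
        unfolding choice_iff by blast
      have "inj k"
      proof (rule injI, rule ccontr)
        fix p q
        assume "k p = k q" "p \<noteq> q"
        with kF(1)[of p] kF(1)[of q] N(3)[of p q] show False
          by auto
      qed
      then have inf: "infinite (range k)"
        by (rule range_inj_infinite)
      have bound: "(\<Sum>n\<in>G. a i n) \<le> real j * \<epsilon>" if i: "i \<in> range k" and G: "finite G" "G \<subseteq> range k" for i G
      proof -
        from i obtain p where p: "i = k p"
          by blast
        \<comment> \<open>The block \<open>N p\<close> meets \<open>range k\<close> only in \<open>k p\<close>, which \<open>F p\<close> omits.\<close>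
        have "G \<inter> F p = {}"
        proof (rule equals0I)
          fix n
          assume n: "n \<in> G \<inter> F p"
          then obtain q where q: "n = k q"
            using G(2) by blast
          with n kF(1)[of q] kF(3)[of p] N(3)[of p q] show False
            by auto
        qed
        then have "(\<Sum>n\<in>G. a i n) + (\<Sum>n\<in>F p. a i n) = (\<Sum>n\<in>G \<union> F p. a i n)"
          using G(1) kF(2) by (simp add: sum.union_disjoint)
        also have "\<dots> \<le> real (Suc j) * \<epsilon>"
        proof (rule Suc.prems(2))
          show "i \<in> I" "finite (G \<union> F p)"
            using kF(1,2) N(1) G(1) p by auto
          have "range k \<subseteq> I" "F p \<subseteq> I"
            using kF(1) kF(3)[of p] N(1) by blast+
          with G(2) show "G \<union> F p \<subseteq> I"
            by blast
        qed
        finally show ?thesis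
          using kF(4)[of p] p by (simp add: algebra_simps)
      qed
      obtain M where "M \<subseteq> range k" "infinite M"
        "\<forall>k\<in>M. \<forall>F. finite F \<and> F \<subseteq> M - {k} \<longrightarrow> (\<Sum>n\<in>F. a k n) \<le> \<epsilon>"
        using Suc.IH[OF inf bound] by blast
      moreover have "range k \<subseteq> I"
        using kF(1) N(1) by blast
      ultimately show ?thesis
        by (intro exI[of _ M] conjI) auto
    qed
  qed
  obtain j where j: "R \<le> real j * \<epsilon>"
    using \<open>\<epsilon> > 0\<close> by (metis order_less_imp_le pos_divide_less_eq reals_Archimedean2)
  have bound: "(\<Sum>n\<in>F. a k n) \<le> real j * \<epsilon>" if "k \<in> I" "finite F" "F \<subseteq> I" for k F
    using rows[OF that] j by linarith
  from *[OF \<open>infinite I\<close> bound] obtain M where M: "M \<subseteq> I" "infinite M"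
    "\<forall>k\<in>M. \<forall>F. finite F \<and> F \<subseteq> M - {k} \<longrightarrow> (\<Sum>n\<in>F. a k n) \<le> \<epsilon>"
    by blast
  show thesis
    by (rule that[OF M(1,2)]) (use M(3) in blast)
qed

section \<open>Weak* cluster points\<close>

text \<open>
  This is the Banach--Alaoglu theorem for nets. The box of all functions \<open>u\<close> with
  \<open>\<bar>u h\<bar> \<le> R * norm h\<close> is compact by Tychonoff's theorem, and a pointwise limit of linear
  functions is linear. The finer filter \<open>G\<close> plays the part of a subnet; it lets inequalities
  pass to the cluster point as for ordinary limits.
\<close>

lemma weak_star_cluster_point:
  fixes \<psi> :: "'i \<Rightarrow> 'a::real_normed_vector \<Rightarrow>\<^sub>L real"
  assumes "F \<noteq> bot" and bounded: "\<forall>\<^sub>F i in F. norm (\<psi> i) \<le> R"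
  obtains \<phi> G where "G \<noteq> bot" "G \<le> F"
    "((\<lambda>i. blinfun_apply (\<psi> i)) \<longlongrightarrow> blinfun_apply \<phi>) G"
proof -
  define K where "K = (\<Pi>\<^sub>E h\<in>(UNIV :: 'a set). {- (R * norm h)..R * norm h})"
  have "compactin (product_topology (\<lambda>_::'a. euclideanreal) UNIV) K"
    unfolding K_def compactin_PiE by simp
  then have "compact K"
    by (simp add: euclidean_product_topology)
  moreover have "\<forall>\<^sub>F u in filtermap (\<lambda>i. blinfun_apply (\<psi> i)) F. u \<in> K"
    unfolding eventually_filtermap using bounded
  proof eventually_elim
    case (elim i)
    have "\<bar>\<psi> i h\<bar> \<le> R * norm h" for h
      using norm_blinfun[of "\<psi> i" h] mult_right_mono[OF elim, of "norm h"] by simp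
    then show ?case
      by (auto simp: K_def abs_le_iff minus_le_iff)
  qed
  ultimately obtain u where u: "inf (nhds u) (filtermap (\<lambda>i. blinfun_apply (\<psi> i)) F) \<noteq> bot"
    and "u \<in> K"
    using \<open>F \<noteq> bot\<close> unfolding compact_filter by (metis filtermap_bot_iff)
  \<comment> \<open>The trace on \<open>F\<close> of the neighbourhoods of \<open>u\<close>: the coarsest refinement along which the net tends to \<open>u\<close>.\<close>
  define G where "G = inf (filtercomap (\<lambda>i. blinfun_apply (\<psi> i)) (nhds u)) F"
  have "G \<noteq> bot"
  proof
    assume "G = bot"
    then obtain P Q where "eventually P (nhds u)" "eventually Q F" "\<And>i. P (blinfun_apply (\<psi> i)) \<Longrightarrow> Q i \<Longrightarrow> False"
      unfolding G_def trivial_limit_def eventually_inf eventually_filtercomap by metis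
    then have "eventually (\<lambda>v. \<not> P v) (filtermap (\<lambda>i. blinfun_apply (\<psi> i)) F)"
      unfolding eventually_filtermap by (metis (mono_tags, lifting) eventually_mono)
    with \<open>eventually P (nhds u)\<close>
    have "eventually (\<lambda>_. False) (inf (nhds u) (filtermap (\<lambda>i. blinfun_apply (\<psi> i)) F))"
      unfolding eventually_inf by blast
    with u show False
      by (simp add: eventually_False)
  qed
  have lim: "((\<lambda>i. blinfun_apply (\<psi> i)) \<longlongrightarrow> u) G"
    unfolding G_def filterlim_def
    by (metis filtermap_filtercomap filtermap_mono inf_le1 order_trans)
  have lim': "((\<lambda>i. \<psi> i h) \<longlongrightarrow> u h) G" for h
    using continuous_on_tendsto_compose[OF continuous_on_product_coordinates lim, of h] by simp
  have "bounded_linear u"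
  proof (rule bounded_linear_intro)
    fix x y :: 'a and r :: real
    show "u (x + y) = u x + u y"
      using tendsto_unique[OF \<open>G \<noteq> bot\<close> lim'[of "x + y"]] tendsto_add[OF lim'[of x] lim'[of y]]
      by (simp add: blinfun.add_right)
    show "u (r *\<^sub>R x) = r *\<^sub>R u x"
      using tendsto_unique[OF \<open>G \<noteq> bot\<close> lim'[of "r *\<^sub>R x"]] tendsto_scaleR[OF tendsto_const lim'[of x]]
      by (simp add: blinfun.scaleR_right)
    have "u x \<in> {- (R * norm x)..R * norm x}"
      using \<open>u \<in> K\<close> unfolding K_def by blast
    then show "norm (u x) \<le> norm x * R"
      by (auto simp: mult.commute)
  qed
  then have "blinfun_apply (Blinfun u) = u"
    by (rule bounded_linear_Blinfun_apply)
  with lim \<open>G \<noteq> bot\<close> show thesis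
    by (intro that[of G "Blinfun u"]) (auto simp: G_def)
qed

lemma weak_star_limit_in_closure_of:
  fixes \<psi> :: "'i \<Rightarrow> 'a::real_normed_vector \<Rightarrow>\<^sub>L real"
  assumes "G \<noteq> bot" and "((\<lambda>i. blinfun_apply (\<psi> i)) \<longlongrightarrow> blinfun_apply \<phi>) G"
    and "\<forall>\<^sub>F i in G. \<psi> i \<in> S"
  shows "\<phi> \<in> weak_star_topology closure_of S"
  unfolding in_closure_of
proof (intro conjI allI impI)
  show "\<phi> \<in> topspace weak_star_topology"
    by (simp add: strong_operator_topology_topspace)
  fix T assume T: "\<phi> \<in> T \<and> openin weak_star_topology T"
  then obtain V where V: "open V" "T = blinfun_apply -` V"
    unfolding strong_operator_topology_def openin_pullback_topology by auto
  with T have "\<forall>\<^sub>F i in G. blinfun_apply (\<psi> i) \<in> V"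
    using assms(2) by (auto intro: topological_tendstoD)
  with assms(3) have "\<forall>\<^sub>F i in G. \<psi> i \<in> S \<and> \<psi> i \<in> T"
    by eventually_elim (simp add: V(2))
  with \<open>G \<noteq> bot\<close> show "\<exists>y. y \<in> S \<and> y \<in> T"
    using eventually_happens by blast
qed

lemma norm_bidual_embed_le: "norm (bidual_embed x) \<le> norm x"
proof (rule norm_blinfun_bound)
  show "norm (bidual_embed x f) \<le> norm x * norm f" for f :: "'a \<Rightarrow>\<^sub>L real"
    using norm_blinfun[of f x] by (simp add: bidual_embed.rep_eq mult.commute)
qed simp

lemma le_infdist_iff:
  fixes x :: "'a::metric_space"
  assumes "S \<noteq> {}"
  shows "c \<le> infdist x S \<longleftrightarrow> (\<forall>y\<in>S. c \<le> dist x y)"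
  using assms cINF_greatest[of S c "dist x"] infdist_le[of _ S x]
  by (fastforce simp: infdist_notempty[OF assms])

section \<open>The inequality valid in every Banach space\<close>

text \<open>
  Testing the weak norm of \<open>g\<close> only on the evaluation at \<open>v / norm v\<close>, an element of the unit ball of
  the bidual, already controls the sums \<open>\<Sum>n. \<bar>g n v\<bar>\<close>.
\<close>

lemma sum_abs_le_norm_if_weak_1_norm_le_1:
  fixes g :: "nat \<Rightarrow> 'a::real_normed_vector \<Rightarrow>\<^sub>L real"
  assumes "weak_1_norm g \<le> 1" and "finite F"
  shows "(\<Sum>n\<in>F. \<bar>g n v\<bar>) \<le> norm v"
proof (cases "v = 0")
  case False
  define f where "f = bidual_embed (v /\<^sub>R norm v)"
  have "norm f \<le> 1"
    unfolding f_def using norm_bidual_embed_le[of "v /\<^sub>R norm v"] False by simp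
  have "ennreal (\<Sum>n\<in>F. \<bar>f (g n)\<bar>) = (\<Sum>n\<in>F. ennreal \<bar>f (g n)\<bar>)"
    by simp
  also have "\<dots> \<le> (\<Sum>n. ennreal \<bar>f (g n)\<bar>)"
    by (rule sum_le_suminf[OF _ \<open>finite F\<close>]) auto
  also have "\<dots> \<le> weak_1_norm g"
    unfolding weak_1_norm_def using \<open>norm f \<le> 1\<close> by (intro SUP_upper) simp
  finally have "(\<Sum>n\<in>F. \<bar>f (g n)\<bar>) \<le> 1"
    using assms(1) by (metis ennreal_le_1 order_trans)
  moreover have "\<bar>f (g n)\<bar> = \<bar>g n v\<bar> / norm v" for n
    by (simp add: f_def bidual_embed.rep_eq blinfun.scaleR_right abs_mult divide_inverse)
  ultimately show ?thesis
    using False by (simp add: sum_divide_distrib[symmetric] pos_divide_le_eq)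
qed (simp add: assms)

text \<open>
  The series \<open>\<Sum>n. t n *\<^sub>R g n\<close> need not converge in the norm of the dual, but it converges
  pointwise, and its pointwise sum is again a functional in the unit ball. This is what allows
  infinitely many of the \<open>g n\<close> to be combined in one functional.
\<close>

lemma blinfun_of_bounded_multiplier:
  fixes g :: "nat \<Rightarrow> 'a::real_normed_vector \<Rightarrow>\<^sub>L real"
  assumes g: "\<And>F v. finite F \<Longrightarrow> (\<Sum>n\<in>F. \<bar>g n v\<bar>) \<le> norm v" and t: "\<And>n. \<bar>t n\<bar> \<le> 1"
  obtains h :: "'a \<Rightarrow>\<^sub>L real" where "norm h \<le> 1" "\<And>v. (\<lambda>n. t n * g n v) sums h v"
proof -
  have le: "\<bar>t n * g n v\<bar> \<le> \<bar>g n v\<bar>" for n v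
    using mult_right_mono[OF t[of n], of "\<bar>g n v\<bar>"] by (simp add: abs_mult)
  have bound: "(\<Sum>n\<in>F. \<bar>t n * g n v\<bar>) \<le> norm v" if "finite F" for F v
    using sum_mono[of F "\<lambda>n. \<bar>t n * g n v\<bar>" "\<lambda>n. \<bar>g n v\<bar>"] le g[OF that, of v] by fastforce
  have summable_abs: "summable (\<lambda>n. \<bar>t n * g n v\<bar>)" for v
    by (rule summableI_nonneg_bounded[where x = "norm v"]) (auto intro: bound)
  then have summable: "summable (\<lambda>n. t n * g n v)" for v
    by (simp add: summable_rabs_cancel)
  have le_norm: "\<bar>\<Sum>n. t n * g n v\<bar> \<le> norm v" for v
    using summable_rabs[OF summable_abs, of v] suminf_le_const[OF summable_abs bound, of v]
    by fastforce
  have lin: "bounded_linear (\<lambda>v. \<Sum>n. t n * g n v)"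
  proof (rule bounded_linear_intro)
    show "(\<Sum>n. t n * g n (x + y)) = (\<Sum>n. t n * g n x) + (\<Sum>n. t n * g n y)" for x y
      by (simp add: blinfun.add_right distrib_left suminf_add summable)
    show "(\<Sum>n. t n * g n (r *\<^sub>R x)) = r *\<^sub>R (\<Sum>n. t n * g n x)" for r x
      using suminf_mult[OF summable, of r x] by (simp add: blinfun.scaleR_right mult.left_commute)
    show "norm (\<Sum>n. t n * g n x) \<le> norm x * 1" for x
      using le_norm[of x] by simp
  qed
  show thesis
  proof
    show "norm (Blinfun (\<lambda>v. \<Sum>n. t n * g n v)) \<le> 1"
      by (rule norm_blinfun_bound) (auto simp: bounded_linear_Blinfun_apply[OF lin] le_norm)
    show "(\<lambda>n. t n * g n v) sums Blinfun (\<lambda>v. \<Sum>n. t n * g n v) v" for v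
      by (simp add: bounded_linear_Blinfun_apply[OF lin] summable_sums[OF summable])
  qed
qed

text \<open>
  One \<open>\<epsilon>\<close> is lost to the off-diagonal terms of the matrix \<open>g n (x k)\<close>, which Rosenthal's lemma makes
  small; the other one to the value at the competitor \<open>v\<close>, which is small once the functional
  uses only indices beyond some \<open>m\<close>. The cluster point \<open>\<phi>\<close> has to be fixed before \<open>v\<close>; this is
  possible because changing \<open>m\<close> affects only finitely many of the inequalities
  \<open>h (x k) \<ge> c - \<epsilon>\<close>.
\<close>

lemma weak_star_closure_point_far_from_space:
  fixes g :: "nat \<Rightarrow> 'a::real_normed_vector \<Rightarrow>\<^sub>L real"
  assumes g: "\<And>F v. finite F \<Longrightarrow> (\<Sum>n\<in>F. \<bar>g n v\<bar>) \<le> norm v"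
    and "bounded A" and "infinite I"
    and x: "\<And>n. n \<in> I \<Longrightarrow> x n \<in> A" "\<And>n. n \<in> I \<Longrightarrow> c \<le> \<bar>g n (x n)\<bar>"
    and "\<epsilon> > 0"
  obtains \<phi> where "\<phi> \<in> weak_star_topology closure_of (bidual_embed ` A)"
    "c - 2 * \<epsilon> \<le> infdist \<phi> (range bidual_embed)"
proof -
  obtain R where R: "\<And>v. v \<in> A \<Longrightarrow> norm v \<le> R"
    using \<open>bounded A\<close> unfolding bounded_iff by blast
  have rows: "(\<Sum>n\<in>F. \<bar>g n (x k)\<bar>) \<le> R" if "k \<in> I" "finite F" for k F
    using g[OF that(2), of "x k"] R[OF x(1)[OF that(1)]] by linarith
  obtain M where M: "M \<subseteq> I" "infinite M"
    "\<And>k F. k \<in> M \<Longrightarrow> finite F \<Longrightarrow> F \<subseteq> M - {k} \<Longrightarrow> (\<Sum>n\<in>F. \<bar>g n (x k)\<bar>) \<le> \<epsilon>"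
    by (rule rosenthal_disjointification[of I \<epsilon> "\<lambda>k n. \<bar>g n (x k)\<bar>" R])
      (use \<open>infinite I\<close> \<open>\<epsilon> > 0\<close> rows in auto)
  \<comment> \<open>Convergence along \<open>F\<close> is convergence of the subsequence with indices in \<open>M\<close>.\<close>
  define F where "F = inf sequentially (principal M)"
  have "F \<noteq> bot"
    using M(2) by (simp add: F_def trivial_limit_def eventually_inf_principal eventually_sequentially
        infinite_nat_iff_unbounded_le)
  have inM: "\<forall>\<^sub>F k in F. k \<in> M" and ge: "\<And>m. \<forall>\<^sub>F k in F. k \<ge> m"
    unfolding F_def eventually_inf_principal by (auto intro: eventually_mono[OF eventually_ge_at_top])
  have "\<forall>\<^sub>F k in F. norm (bidual_embed (x k)) \<le> R"
    using inM by eventually_elim (use M(1) R x(1) norm_bidual_embed_le order_trans in blast)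
  then obtain \<phi> G where G: "G \<noteq> bot" "G \<le> F"
    and lim: "((\<lambda>k. blinfun_apply (bidual_embed (x k))) \<longlongrightarrow> blinfun_apply \<phi>) G"
    using weak_star_cluster_point[OF \<open>F \<noteq> bot\<close>, of "\<lambda>k. bidual_embed (x k)" R] by blast
  have "\<forall>\<^sub>F k in G. bidual_embed (x k) \<in> bidual_embed ` A"
    using filter_leD[OF G(2) inM] by eventually_elim (use M(1) x(1) in blast)
  with G(1) lim have "\<phi> \<in> weak_star_topology closure_of (bidual_embed ` A)"
    by (rule weak_star_limit_in_closure_of)
  moreover have "c - 2 * \<epsilon> \<le> dist \<phi> (bidual_embed v)" for v
  proof -
    have "summable (\<lambda>n. \<bar>g n v\<bar>)"
      by (rule summableI_nonneg_bounded[where x = "norm v"]) (auto intro: g)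
    then obtain m where m: "\<And>N. \<bar>\<Sum>n=m..<N. \<bar>g n v\<bar>\<bar> < \<epsilon>"
      using \<open>\<epsilon> > 0\<close> unfolding summable_Cauchy real_norm_def by blast
    define t where "t = (\<lambda>n. if n \<in> M \<and> n \<ge> m then sgn (g n (x n)) else 0)"
    have "\<bar>t n\<bar> \<le> 1" for n
      by (simp add: t_def abs_sgn_eq)
    then obtain h :: "'a \<Rightarrow>\<^sub>L real" where h: "norm h \<le> 1" "\<And>v. (\<lambda>n. t n * g n v) sums h v"
      using blinfun_of_bounded_multiplier[OF g, where t = t] by blast
    have hv: "h v \<le> \<epsilon>"
    proof (rule LIMSEQ_le_const2)
      show "(\<lambda>N. \<Sum>n<N. t n * g n v) \<longlonglongrightarrow> h v"
        using h(2) by (simp add: sums_def)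
      have "(\<Sum>n<N. t n * g n v) \<le> \<epsilon>" for N
      proof -
        have "(\<Sum>n<N. t n * g n v) = (\<Sum>n=m..<N. t n * g n v)"
          by (rule sum.mono_neutral_right) (auto simp: t_def)
        also have "\<dots> \<le> (\<Sum>n=m..<N. \<bar>g n v\<bar>)"
          by (rule sum_mono) (auto simp: t_def sgn_if)
        finally show ?thesis
          using m[of N] by linarith
      qed
      then show "\<exists>N0. \<forall>N\<ge>N0. (\<Sum>n<N. t n * g n v) \<le> \<epsilon>"
        by blast
    qed
    have hx: "c - \<epsilon> \<le> h (x k)" if k: "k \<in> M" "k \<ge> m" for k
    proof (rule LIMSEQ_le_const)
      show "(\<lambda>N. \<Sum>n<N. t n * g n (x k)) \<longlonglongrightarrow> h (x k)"
        using h(2) by (simp add: sums_def)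
      have "c - \<epsilon> \<le> (\<Sum>n<N. t n * g n (x k))" if "N > k" for N
      proof -
        let ?F = "M \<inter> {..<N} - {k}"
        have "(\<Sum>n<N. t n * g n (x k)) = t k * g k (x k) + (\<Sum>n\<in>{..<N} - {k}. t n * g n (x k))"
          using that by (simp add: sum.remove)
        also have "t k * g k (x k) = \<bar>g k (x k)\<bar>"
          using k by (simp add: t_def sgn_if)
        also have "(\<Sum>n\<in>{..<N} - {k}. t n * g n (x k)) = (\<Sum>n\<in>?F. t n * g n (x k))"
          by (rule sum.mono_neutral_right) (auto simp: t_def)
        finally have "(\<Sum>n<N. t n * g n (x k)) = \<bar>g k (x k)\<bar> + (\<Sum>n\<in>?F. t n * g n (x k))" .
        moreover have "(\<Sum>n\<in>?F. t n * g n (x k)) \<ge> (\<Sum>n\<in>?F. - \<bar>g n (x k)\<bar>)"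
          by (rule sum_mono) (auto simp: t_def sgn_if)
        moreover have "(\<Sum>n\<in>?F. \<bar>g n (x k)\<bar>) \<le> \<epsilon>"
          by (rule M(3)[OF k(1)]) auto
        moreover have "c \<le> \<bar>g k (x k)\<bar>"
          using k(1) M(1) x(2) by blast
        ultimately show ?thesis
          by (simp add: sum_negf)
      qed
      then show "\<exists>N0. \<forall>N\<ge>N0. c - \<epsilon> \<le> (\<Sum>n<N. t n * g n (x k))"
        by (meson Suc_le_eq)
    qed
    have "c - \<epsilon> \<le> \<phi> h"
    proof (rule tendsto_lowerbound[OF _ _ G(1)])
      show "((\<lambda>k. h (x k)) \<longlongrightarrow> \<phi> h) G"
        using continuous_on_tendsto_compose[OF continuous_on_product_coordinates lim, of h]
        by (simp add: bidual_embed.rep_eq)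
      show "\<forall>\<^sub>F k in G. c - \<epsilon> \<le> h (x k)"
        using filter_leD[OF G(2) inM] filter_leD[OF G(2) ge[of m]] by eventually_elim (rule hx)
    qed
    with hv have "c - 2 * \<epsilon> \<le> (\<phi> - bidual_embed v) h"
      by (simp add: blinfun.diff_left bidual_embed.rep_eq)
    also have "\<dots> \<le> norm (\<phi> - bidual_embed v) * norm h"
      using norm_blinfun[of "\<phi> - bidual_embed v" h] by simp
    also have "\<dots> \<le> norm (\<phi> - bidual_embed v)"
      using h(1) by (simp add: mult_left_le)
    finally show ?thesis
      by (simp add: dist_norm)
  qed
  ultimately show thesis
    by (intro that[of \<phi>]) (simp_all add: le_infdist_iff)
qed

lemma iota1_le_wk:
  fixes A :: "'a::banach set"
  assumes "bounded A"
  shows "iota1 A \<le> wk A"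
  unfolding iota1_def
proof (rule SUP_least, rule ccontr)
  fix g :: "nat \<Rightarrow> 'a \<Rightarrow>\<^sub>L real"
  assume g: "g \<in> {g. weakly_1_summable g \<and> weak_1_norm g \<le> 1}"
  let ?s = "\<lambda>n. SUP x\<in>A. ennreal \<bar>g n x\<bar>"
  assume "\<not> limsup ?s \<le> wk A"
  then obtain d' c' where *: "wk A < d'" "d' < c'" "c' < limsup ?s"
    by (meson dense not_le)
  obtain d where d: "d \<ge> 0" "d' = ennreal d"
    using *(2) by (cases d') auto
  obtain c where c: "c \<ge> 0" "c' = ennreal c"
    using *(3) by (cases c') auto
  have "d < c"
    using * d c by (simp add: ennreal_less_iff)
  define I where "I = {n. \<exists>x\<in>A. c < \<bar>g n x\<bar>}"
  have "infinite I"
  proof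
    assume "finite I"
    then have "\<forall>\<^sub>F n in sequentially. n \<notin> I"
      by (simp add: cofinite_eq_sequentially[symmetric] eventually_cofinite)
    then have "\<forall>\<^sub>F n in sequentially. ?s n \<le> ennreal c"
      by eventually_elim (auto simp: I_def not_less intro!: SUP_least ennreal_leI)
    then have "limsup ?s \<le> ennreal c"
      by (rule Limsup_bounded)
    with *(3) c show False
      by simp
  qed
  have "\<forall>n\<in>I. \<exists>x. x \<in> A \<and> c < \<bar>g n x\<bar>"
    by (auto simp: I_def)
  then obtain x where "\<forall>n\<in>I. x n \<in> A \<and> c < \<bar>g n (x n)\<bar>"
    unfolding bchoice_iff by blast
  then have x: "\<And>n. n \<in> I \<Longrightarrow> x n \<in> A" "\<And>n. n \<in> I \<Longrightarrow> c \<le> \<bar>g n (x n)\<bar>"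
    by (auto intro: less_imp_le)
  have pos: "(c - d) / 2 > 0"
    using \<open>d < c\<close> by simp
  have "(\<Sum>n\<in>F. \<bar>g n v\<bar>) \<le> norm v" if "finite F" for F v
    using g that by (intro sum_abs_le_norm_if_weak_1_norm_le_1) auto
  then obtain \<phi>
    where "\<phi> \<in> weak_star_topology closure_of (bidual_embed ` A)"
      "c - 2 * ((c - d) / 2) \<le> infdist \<phi> (range bidual_embed)"
    by (rule weak_star_closure_point_far_from_space[OF _ \<open>bounded A\<close> \<open>infinite I\<close> x pos])
  then have "ennreal d \<le> wk A"
    unfolding wk_def by (intro SUP_upper2[of \<phi>] ennreal_leI) (auto simp: field_simps)
  with *(1) d show False
    by simp
qed

section \<open>Tails in the space of absolutely summable sequences\<close>

lift_definition l1_coord :: "nat \<Rightarrow> l1 \<Rightarrow>\<^sub>L real" is "\<lambda>n x. l1_nth x n"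
  by (rule bounded_linear_intro[where K = 1])
    (auto simp: plus_l1.rep_eq scaleR_l1.rep_eq abs_l1_nth_le_norm)

lift_definition l1_unit :: "nat \<Rightarrow> l1" is "\<lambda>n i. if i = n then 1 else 0"
  by (rule summable_finite[of "{n}" for n]) auto

lemma l1_nth_sum: "l1_nth (\<Sum>i\<in>F. f i) n = (\<Sum>i\<in>F. l1_nth (f i) n)"
  by (induction F rule: infinite_finite_induct) (auto simp: plus_l1.rep_eq zero_l1.rep_eq)

lemma norm_l1_remove_initial_segment:
  "norm (x - (\<Sum>i<N. l1_nth x i *\<^sub>R l1_unit i)) = (\<Sum>n. \<bar>l1_nth x (n + N)\<bar>)"
proof -
  let ?y = "x - (\<Sum>i<N. l1_nth x i *\<^sub>R l1_unit i)"
  have nth: "l1_nth ?y n = (if n < N then 0 else l1_nth x n)" for n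
    by (auto simp: minus_l1.rep_eq l1_nth_sum scaleR_l1.rep_eq l1_unit.rep_eq
        if_distrib[of "\<lambda>u. _ * u"] sum.delta cong: if_cong)
  have "norm ?y = (\<Sum>n. \<bar>l1_nth ?y (n + N)\<bar>) + (\<Sum>n<N. \<bar>l1_nth ?y n\<bar>)"
    unfolding norm_l1_def by (rule suminf_split_initial_segment[OF summable_abs_l1_nth])
  then show ?thesis
    by (simp add: nth)
qed

text \<open>
  The competitor is the image \<open>y\<close> of \<open>\<phi>\<close> under the second adjoint of the projection \<open>P\<close> to the
  first \<open>N\<close> coordinates. It lies in the space since \<open>P\<close> has finite rank. For \<open>f\<close> in the dual,
  \<open>(\<phi> - y) f = \<phi> (f \<circ> (id - P))\<close>, and the bound \<open>c * norm f\<close>, valid for the elements of \<open>A\<close>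
  in place of \<open>\<phi>\<close>, passes to the weak* closure.
\<close>

lemma infdist_weak_star_closure_le_tail:
  assumes \<phi>: "\<phi> \<in> weak_star_topology closure_of (bidual_embed ` A)"
    and tail: "\<And>x. x \<in> A \<Longrightarrow> (\<Sum>n. \<bar>l1_nth x (n + N)\<bar>) \<le> c"
    and "c \<ge> 0"
  shows "infdist \<phi> (range (bidual_embed :: l1 \<Rightarrow> _)) \<le> c"
proof -
  define y where "y = (\<Sum>i<N. \<phi> (l1_coord i) *\<^sub>R l1_unit i)"
  have "norm (\<phi> - bidual_embed y) \<le> c"
  proof (rule norm_blinfun_bound[OF \<open>c \<ge> 0\<close>])
    fix f :: "l1 \<Rightarrow>\<^sub>L real"
    \<comment> \<open>\<open>f'\<close> is \<open>f \<circ> (id - P)\<close>.\<close>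
    define f' where "f' = f - (\<Sum>i<N. f (l1_unit i) *\<^sub>R l1_coord i)"
    have "(\<phi> - bidual_embed y) f = \<phi> f'"
      by (simp add: y_def f'_def blinfun.diff_left blinfun.diff_right bidual_embed.rep_eq
          blinfun.sum_right blinfun.scaleR_right mult.commute)
    moreover have "\<phi> \<in> {\<psi> \<in> topspace weak_star_topology. \<psi> f' \<in> {- (c * norm f)..c * norm f}}"
    proof (rule subsetD[OF closure_of_minimal \<phi>])
      show "closedin weak_star_topology
        {\<psi> \<in> topspace weak_star_topology. \<psi> f' \<in> {- (c * norm f)..c * norm f}}"
        by (rule closedin_continuous_map_preimage[OF strong_operator_topology_continuous_evaluation])
          simp
      have "\<bar>f' x\<bar> \<le> c * norm f" if "x \<in> A" for x
      proof -
        have "f' x = f (x - (\<Sum>i<N. l1_nth x i *\<^sub>R l1_unit i))"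
          by (simp add: f'_def blinfun.diff_left blinfun.diff_right blinfun.sum_left blinfun.sum_right
              blinfun.scaleR_left blinfun.scaleR_right l1_coord.rep_eq mult.commute)
        also have "\<bar>\<dots>\<bar> \<le> norm f * (\<Sum>n. \<bar>l1_nth x (n + N)\<bar>)"
          using norm_blinfun[of f "x - (\<Sum>i<N. l1_nth x i *\<^sub>R l1_unit i)"]
          by (simp add: norm_l1_remove_initial_segment)
        also have "\<dots> \<le> norm f * c"
          using tail[OF that] by (rule mult_left_mono) simp
        finally show ?thesis
          by (simp add: mult.commute)
      qed
      then show "bidual_embed ` A \<subseteq>
        {\<psi> \<in> topspace weak_star_topology. \<psi> f' \<in> {- (c * norm f)..c * norm f}}"
        by (auto simp: strong_operator_topology_topspace bidual_embed.rep_eq abs_le_iff minus_le_iff)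
    qed
    ultimately show "norm ((\<phi> - bidual_embed y) f) \<le> c * norm f"
      by auto
  qed
  then show ?thesis
    using infdist_le[of "bidual_embed y" "range bidual_embed" \<phi>] by (simp add: dist_norm)
qed

text \<open>
  The blocks \<open>{a k..<a (Suc k)}\<close> are chosen one after the other: a tail of mass more than \<open>c\<close>
  starting at \<open>a k\<close> has a finite piece with mass more than \<open>c\<close>, and the next block starts
  where that piece ends. Since the functionals \<open>g k\<close> have disjoint supports, all signed sums
  of them stay in the unit ball of the dual, which bounds \<open>\<Sum>k. \<bar>f (g k)\<bar>\<close> by \<open>norm f\<close> for every
  \<open>f\<close> in the bidual.
\<close>

lemma iota1_ge_if_tails_large:
  assumes "\<And>N. \<exists>x\<in>A. c < (\<Sum>n. \<bar>l1_nth x (n + N)\<bar>)"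
  shows "ennreal c \<le> iota1 A"
proof -
  have "\<exists>x\<in>A. \<exists>b\<ge>N. c < (\<Sum>i=N..<b. \<bar>l1_nth x i\<bar>)" for N
  proof -
    obtain x where x: "x \<in> A" "c < (\<Sum>n. \<bar>l1_nth x (n + N)\<bar>)"
      using assms by blast
    have "summable (\<lambda>n. \<bar>l1_nth x (n + N)\<bar>)"
      using summable_abs_l1_nth by (subst summable_iff_shift)
    then obtain m where "c < (\<Sum>n<m. \<bar>l1_nth x (n + N)\<bar>)"
      using x(2) suminf_le_const[of "\<lambda>n. \<bar>l1_nth x (n + N)\<bar>" c] by (meson not_le)
    also have "\<dots> = (\<Sum>i=N..<m + N. \<bar>l1_nth x i\<bar>)"
      using sum.shift_bounds_nat_ivl[of "\<lambda>i. \<bar>l1_nth x i\<bar>" 0 N m] by (simp add: lessThan_atLeast0)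
    finally show ?thesis
      using x(1) by (intro bexI[of _ x] exI[of _ "m + N"]) auto
  qed
  then obtain X B where XB: "\<And>N. X N \<in> A" "\<And>N. B N \<ge> N"
    "\<And>N. c < (\<Sum>i=N..<B N. \<bar>l1_nth (X N) i\<bar>)"
    by metis
  define a where "a = (\<lambda>k. (B ^^ k) 0)"
  have a_le: "a k \<le> a (Suc k)" for k
    using XB(2) by (simp add: a_def)
  have blocks: "(\<Sum>k<K. \<Sum>i=a k..<a (Suc k). u i) = (\<Sum>i<a K. u i)" for K and u :: "nat \<Rightarrow> real"
  proof (induction K)
    case (Suc K)
    then show ?case
      using sum.atLeastLessThan_concat[of 0 "a K" "a (Suc K)" u] a_le[of K]
      by (simp add: lessThan_atLeast0)
  qed (simp add: a_def)
  define g where "g = (\<lambda>k. \<Sum>i=a k..<a (Suc k). sgn (l1_nth (X (a k)) i) *\<^sub>R l1_coord i)"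
  have g_apply: "g k x = (\<Sum>i=a k..<a (Suc k). sgn (l1_nth (X (a k)) i) * l1_nth x i)" for k x
    by (simp add: g_def blinfun.sum_left blinfun.scaleR_left l1_coord.rep_eq)
  have g_le: "\<bar>g k x\<bar> \<le> (\<Sum>i=a k..<a (Suc k). \<bar>l1_nth x i\<bar>)" for k x
    unfolding g_apply by (rule order_trans[OF sum_abs sum_mono]) (auto simp: abs_mult abs_sgn_eq)
  have weak: "(\<Sum>k<K. \<bar>f (g k)\<bar>) \<le> norm f" for f :: "(l1 \<Rightarrow>\<^sub>L real) \<Rightarrow>\<^sub>L real" and K
  proof -
    \<comment> \<open>With these signs \<open>f ?h\<close> is the sum to be bounded.\<close>
    let ?h = "\<Sum>k<K. sgn (f (g k)) *\<^sub>R g k"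
    have "norm ?h \<le> 1"
    proof (rule norm_blinfun_bound)
      fix x
      have "\<bar>?h x\<bar> \<le> (\<Sum>k<K. \<bar>g k x\<bar>)"
        unfolding blinfun.sum_left blinfun.scaleR_left
        by (rule order_trans[OF sum_abs sum_mono]) (auto simp: abs_mult abs_sgn_eq)
      also have "\<dots> \<le> (\<Sum>i<a K. \<bar>l1_nth x i\<bar>)"
        unfolding blocks[symmetric] by (rule sum_mono) (rule g_le)
      also have "\<dots> \<le> norm x"
        by (rule sum_abs_l1_nth_le_norm)
      finally show "norm (?h x) \<le> 1 * norm x"
        by simp
    qed simp
    have "(\<Sum>k<K. \<bar>f (g k)\<bar>) = f ?h"
      by (simp add: blinfun.sum_right blinfun.scaleR_right abs_sgn mult.commute)
    also have "\<dots> \<le> norm f * norm ?h"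
      using norm_blinfun[of f ?h] by simp
    also have "\<dots> \<le> norm f"
      using \<open>norm ?h \<le> 1\<close> by (simp add: mult_left_le)
    finally show ?thesis .
  qed
  have "weakly_1_summable g"
    unfolding weakly_1_summable_def
    by (intro allI summableI_nonneg_bounded[OF _ weak]) simp
  moreover have "weak_1_norm g \<le> 1"
    unfolding weak_1_norm_def
  proof (rule SUP_least)
    fix f :: "(l1 \<Rightarrow>\<^sub>L real) \<Rightarrow>\<^sub>L real"
    assume "f \<in> cball 0 1"
    then have "(\<Sum>k<K. \<bar>f (g k)\<bar>) \<le> 1" for K
      using weak[of f K] by simp
    then show "(\<Sum>k. ennreal \<bar>f (g k)\<bar>) \<le> 1"
      by (intro suminf_le_const) (auto simp: ennreal_le_1)
  qed
  moreover have "ennreal c \<le> limsup (\<lambda>k. SUP x\<in>A. ennreal \<bar>g k x\<bar>)"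
  proof (rule le_Limsup, simp, rule always_eventually, rule allI)
    fix k
    have "c < g k (X (a k))"
      using XB(3)[of "a k"] by (simp add: g_apply a_def abs_sgn mult.commute)
    then show "ennreal c \<le> (SUP x\<in>A. ennreal \<bar>g k x\<bar>)"
      using XB(1) by (intro SUP_upper2[of "X (a k)"] ennreal_leI) auto
  qed
  ultimately show ?thesis
    unfolding iota1_def by (intro SUP_upper2[of g]) auto
qed

theorem theorem4p6:
  fixes A :: "l1 set"
  assumes "bounded A"
  shows "wk A = iota1 A"
proof (rule antisym)
  show "wk A \<le> iota1 A"
    unfolding wk_def
  proof (rule SUP_least, rule ccontr)
    fix \<phi>
    let ?d = "infdist \<phi> (range (bidual_embed :: l1 \<Rightarrow> _))"
    assume \<phi>: "\<phi> \<in> weak_star_topology closure_of (bidual_embed ` A)"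
      and "\<not> ennreal ?d \<le> iota1 A"
    then obtain c' where c': "iota1 A < c'" "c' < ennreal ?d"
      by (meson dense not_le)
    then obtain c where c: "c \<ge> 0" "c' = ennreal c"
      by (cases c') auto
    with c'(2) have "c < ?d"
      by (simp add: ennreal_less_iff)
    then have "\<exists>x\<in>A. c < (\<Sum>n. \<bar>l1_nth x (n + N)\<bar>)" for N
      using infdist_weak_star_closure_le_tail[OF \<phi> _ \<open>c \<ge> 0\<close>, of N] by (meson not_le)
    then have "ennreal c \<le> iota1 A"
      by (rule iota1_ge_if_tails_large)
    with c'(1) c show False
      by simp
  qed
  show "iota1 A \<le> wk A"
    using assms by (rule iota1_le_wk)
qed

end
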